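(* For every $t \in (1,2)$, $\gamma(t) = 1$, where for $t \in (1,2]$ the number $\gamma(t) \in [0,1]$ is defined as the infimum over those $\gamma \in [0,1]$ for which the following holds: whenever $K \subset \mathbb{R}^{2}$ is compact with $\mathcal{H}^{t}(K) < \infty$, there exists a set $E \subset S^{1}$ with $\dim_{\mathrm{H}} E \leq \gamma$ such that for $\mathcal{H}^{t}$ almost all $x \in K$ it holds $|K \cap \ell_{x,e}| \geq 2$ for all $e \in S^{1} \setminus E$.
   Context: $\ell_{x,e} := x + \mathrm{span}(e)$ for $x \in \mathbb{R}^{2}$ and $e \in S^{1}$; $\mathcal{H}^{t}$ is $t$-dimensional Hausdorff measure, $\dim_{\mathrm{H}}$ is Hausdorff dimension, and $|\cdot|$ denotes cardinality. Note that the set $E$ may depend on $K$ but not on the point $x$. *)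

theory Defs
  imports "HOL-Analysis.Analysis"
begin

text \<open>
  Hausdorff measure is taken as an outer measure on all subsets, without normalising constant.
  The conventions are \<open>diam {} ^ s = 0\<close> and \<open>diam U ^ 0 = 1\<close> for nonempty \<open>U\<close>; the
  explicit case distinction is needed because \<open>0 powr 0 = 0\<close>.
\<close>

definition diam_pow :: "real \<Rightarrow> 'a::metric_space set \<Rightarrow> ennreal" where
  "diam_pow s U = (if U = {} then 0 else if s = 0 then 1 else ennreal (diameter U powr s))"

text \<open>Boundedness is required of covering sets since \<^const>\<open>diameter\<close> is unspecified otherwise.\<close>

definition delta_covers :: "real \<Rightarrow> 'a::metric_space set \<Rightarrow> (nat \<Rightarrow> 'a set) set" where
  "delta_covers \<delta> A = {U. (\<forall>i. bounded (U i) \<and> diameter (U i) \<le> \<delta>) \<and> A \<subseteq> (\<Union>i. U i)}"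

definition hausdorff_premeasure :: "real \<Rightarrow> real \<Rightarrow> 'a::metric_space set \<Rightarrow> ennreal" where
  "hausdorff_premeasure \<delta> s A = (INF U\<in>delta_covers \<delta> A. \<Sum>i. diam_pow s (U i))"

definition hausdorff_measure :: "real \<Rightarrow> 'a::metric_space set \<Rightarrow> ennreal" where
  "hausdorff_measure s A = (SUP \<delta>\<in>{0<..}. hausdorff_premeasure \<delta> s A)"

definition hausdorff_dim :: "'a::metric_space set \<Rightarrow> ennreal" where
  "hausdorff_dim A = (INF s\<in>{s. 0 \<le> s \<and> hausdorff_measure s A = 0}. ennreal s)"

definition hausdorff_ae_in :: "real \<Rightarrow> 'a::metric_space set \<Rightarrow> ('a \<Rightarrow> bool) \<Rightarrow> bool" where
  "hausdorff_ae_in t K P \<longleftrightarrow> hausdorff_measure t {x \<in> K. \<not> P x} = 0"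

definition unit_circle :: "(real^2) set" where
  "unit_circle = sphere 0 1"

definition line_through :: "real^2 \<Rightarrow> real^2 \<Rightarrow> (real^2) set" where
  "line_through x e = (\<lambda>v. x + v) ` span {e}"

text \<open>The first disjunct is needed because \<^const>\<open>card\<close> is \<open>0\<close> on infinite sets.\<close>

definition at_least_two :: "'a set \<Rightarrow> bool" where
  "at_least_two A \<longleftrightarrow> infinite A \<or> card A \<ge> 2"

definition gamma_admissible :: "real \<Rightarrow> real \<Rightarrow> bool" where
  "gamma_admissible t \<gamma> \<longleftrightarrow>
    (\<forall>K :: (real^2) set. compact K \<and> hausdorff_measure t K < \<infinity> \<longrightarrow>
      (\<exists>E \<subseteq> unit_circle. hausdorff_dim E \<le> ennreal \<gamma> \<and>
        hausdorff_ae_in t K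
          (\<lambda>x. \<forall>e \<in> unit_circle - E. at_least_two (K \<inter> line_through x e))))"

text \<open>
  The infimum is over a nonempty set for every \<open>t\<close>: the value \<open>1\<close> is admissible,
  with the whole circle as exceptional set.
\<close>

definition gamma_exponent :: "real \<Rightarrow> real" where
  "gamma_exponent t = Inf {\<gamma> \<in> {0..1}. gamma_admissible t \<gamma>}"

end

theory Submission
  imports Defs "HOL-Probability.Infinite_Product_Measure" "HOL-Probability.Probability_Mass_Function"
begin

text \<open>
  The value \<open>1\<close> is admissible because the whole circle, of dimension at most \<open>1\<close>, may be removed.
  What has to be shown is that no \<open>\<gamma> < 1\<close> is admissible, and for this a single compact set \<open>K\<close>
  that is a graph in polar coordinates around a point \<open>p\<close> suffices: a line through \<open>p\<close> meets \<open>K\<close>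
  at most once, so at every \<open>x \<in> K\<close> the direction from \<open>p\<close> to \<open>x\<close> is exceptional. A set \<open>E\<close>
  that does not depend on \<open>x\<close> must then contain the directions of almost all points of \<open>K\<close>. This is
  impossible when \<open>dim E \<le> \<gamma>\<close>, provided that \<open>K\<close> carries a probability measure
  which charges no Hausdorff null set of order \<open>t\<close> and whose image under the direction map
  charges no set of dimension at most \<open>\<gamma>\<close>.

  The set \<open>K\<close> is the image of coin sequences \<open>a\<close>. Fix \<open>d < 1\<close> with \<open>d > \<gamma>\<close> and \<open>d > t / 2\<close>, and put
  \<open>l = 2 powr (- 1 / d) < 1/2\<close>. The numbers \<open>u = (\<Sum>i. a i * l ^ i)\<close> fill a Cantor set of dimension
  \<open>d\<close>, on which different sequences stay apart: if \<open>u\<close> is known up to a small multiple of \<open>l ^ n\<close>, then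
  the digits below \<open>n\<close> are known. The height over \<open>u\<close> is \<open>y = (\<Sum>j. a (h j) * l ^ j)\<close>, where
  \<open>h j = \<lfloor>j / r\<rfloor>\<close> and \<open>r = 2 - t / d\<close>, and \<open>K\<close> consists of the points \<open>(u (1 + y), y)\<close>, which lie on the
  lines \<open>X = u (1 + Y)\<close> through \<open>p = (0, -1)\<close>. A point of \<open>K\<close>, known up to a small multiple of \<open>l ^ n\<close>,
  determines the digits at positions below \<open>n\<close> and at the positions \<open>h j\<close> with \<open>j < n\<close>, and it is
  determined by them up to a multiple of \<open>l ^ n\<close>. These are \<open>(2 - r) n = (t / d) n\<close> digits up to a
  bounded error (\<open>card_digit_set_bounds\<close>), so \<open>K\<close> falls at the scale \<open>l ^ n\<close> into at most about
  \<open>2 powr (t n / d) = (l ^ n) powr (- t)\<close> pieces, all of the same coin measure. Counting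
  the pieces bounds the Hausdorff measure of \<open>K\<close> from above. From below, the mass distribution
  principle \<open>hausdorff_null_preimage\<close> applies twice: to the map onto \<open>K\<close> with
  exponent \<open>t\<close>, and to the map onto the directions with an exponent \<open>s < d\<close> for which \<open>E\<close> is null. If
  \<open>\<gamma>\<close> were admissible, the sequences with direction in \<open>E\<close> and the remaining ones would both
  lie in null sets of the coin measure, although together they are all sequences.
\<close>

section \<open>The coin_measure measure and Hausdorff null sets\<close>

definition coin_measure :: "(nat \<Rightarrow> bool) measure" where
  "coin_measure = PiM UNIV (\<lambda>_. measure_pmf (bernoulli_pmf (1/2)))"

definition cylinder :: "nat set \<Rightarrow> (nat \<Rightarrow> bool) \<Rightarrow> (nat \<Rightarrow> bool) set" where
  "cylinder J a = {b. \<forall>i\<in>J. b i = a i}"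

lemma prob_space_coin_measure: "prob_space coin_measure"
  unfolding coin_measure_def by (intro prob_space_PiM prob_space_measure_pmf)

lemma space_coin_measure: "space coin_measure = UNIV"
  by (simp add: coin_measure_def space_PiM PiE_def)

lemma cylinder_coin_measure:
  assumes "finite J"
  shows "cylinder J a \<in> sets coin_measure" "emeasure coin_measure (cylinder J a) = ennreal ((1/2) ^ card J)"
proof -
  interpret product_prob_space "\<lambda>_::nat. measure_pmf (bernoulli_pmf (1/2))" UNIV
    by (intro product_prob_spaceI prob_space_measure_pmf)
  have cylinder: "cylinder J a = prod_emb UNIV (\<lambda>_. measure_pmf (bernoulli_pmf (1/2))) J (Pi\<^sub>E J (\<lambda>i. {a i}))"
    by (rule set_eqI) (simp add: cylinder_def prod_emb_def PiE_iff)
  show "cylinder J a \<in> sets coin_measure"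
    unfolding cylinder coin_measure_def using assms by (intro sets_PiM_I) auto
  have "emeasure coin_measure (cylinder J a) = (\<Prod>i\<in>J. emeasure (measure_pmf (bernoulli_pmf (1/2))) {a i})"
    unfolding cylinder coin_measure_def using assms by (intro emeasure_PiM_emb) auto
  also have "\<dots> = (\<Prod>i\<in>J. ennreal (1/2))"
  proof (intro prod.cong refl)
    fix i show "emeasure (measure_pmf (bernoulli_pmf (1/2))) {a i} = ennreal (1/2)"
      by (cases "a i") (simp_all add: emeasure_pmf_single)
  qed
  finally show "emeasure coin_measure (cylinder J a) = ennreal ((1/2) ^ card J)"
    by (simp only: prod_constant ennreal_power[of "1/2"])
qed

text \<open>
  The separation hypothesis makes a set of diameter below \<open>c * l ^ n\<close> meet the image of only one
  cylinder over \<open>J n\<close>. So the mass seen by \<open>U\<close> is at most the mass of that cylinder for the largest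
  \<open>n\<close> which the diameter of \<open>U\<close> allows; the factor \<open>(l * c) powr - s\<close> accounts for \<open>c\<close> and
  for the gap between consecutive scales. A measurable superset is produced since \<open>U\<close> is arbitrary.
\<close>

lemma mass_of_preimage:
  fixes \<phi> :: "(nat \<Rightarrow> bool) \<Rightarrow> 'a::metric_space" and C l c s :: real
  assumes fin: "\<And>n. finite (J n)" and l: "0 < l" "l < 1" and c: "0 < c" and s: "0 \<le> s"
    and sep: "\<And>n a b i. dist (\<phi> a) (\<phi> b) < c * l ^ n \<Longrightarrow> i \<in> J n \<Longrightarrow> a i = b i"
    and card: "\<And>n. (1/2) ^ card (J n) \<le> C * (l powr s) ^ n"
    and U: "bounded U" "diameter U < c"
  shows "\<exists>B\<in>sets coin_measure. \<phi> -` U \<subseteq> B \<and> emeasure coin_measure B \<le> ennreal (C * (l * c) powr - s) * diam_pow s U"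
proof (cases "\<phi> -` U = {}")
  case True
  then show ?thesis by (intro bexI[of _ "{}"]) auto
next
  case False
  then obtain a where a: "\<phi> a \<in> U" by auto
  then have Une: "U \<noteq> {}" by auto
  define D where "D = diameter U"
  have D0: "0 \<le> D" using U by (simp add: D_def diameter_ge_0)
  define S where "S = {n. D < c * l ^ n}"
  have S0: "0 \<in> S" using U by (simp add: S_def D_def)
  \<comment> \<open>Intersecting over all admissible scales also covers diameter zero, where no largest scale exists.\<close>
  define B where "B = (\<Inter>n\<in>S. cylinder (J n) a)"
  have meas: "B \<in> sets coin_measure"
    unfolding B_def using S0 by (intro sets.countable_INT') (auto intro: cylinder_coin_measure fin)
  have sub: "\<phi> -` U \<subseteq> B"
  proof
    fix b assume "b \<in> \<phi> -` U"
    then have "dist (\<phi> b) (\<phi> a) \<le> D"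
      using a U diameter_bounded_bound by (auto simp: D_def)
    then have "dist (\<phi> b) (\<phi> a) < c * l ^ n" if "n \<in> S" for n
      using that by (simp add: S_def)
    then show "b \<in> B" unfolding B_def cylinder_def using sep by blast
  qed
  have C0: "0 \<le> C" using card[of 0] by (simp add: order.trans[rotated])
  have bound: "emeasure coin_measure B \<le> ennreal (C * (l powr s) ^ n)" if "n \<in> S" for n
  proof -
    have "emeasure coin_measure B \<le> emeasure coin_measure (cylinder (J n) a)"
      using that by (intro emeasure_mono) (auto simp: B_def intro: cylinder_coin_measure fin)
    also have "\<dots> \<le> ennreal (C * (l powr s) ^ n)"
      using card[of n] by (simp add: cylinder_coin_measure fin ennreal_leI)
    finally show ?thesis .
  qed
  have lim: "(\<lambda>n. c * l ^ n) \<longlonglongrightarrow> 0" using l by (auto intro!: tendsto_eq_intros LIMSEQ_realpow_zero)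
  have "emeasure coin_measure B \<le> ennreal (C * (l * c) powr - s) * diam_pow s U"
  proof (cases "s = 0")
    case True
    then show ?thesis using bound[OF S0] Une l c by (simp add: diam_pow_def)
  next
    case s': False
    show ?thesis
    proof (cases "D = 0")
      case True
      have "(\<lambda>n. ennreal (C * (l powr s) ^ n)) \<longlonglongrightarrow> ennreal (C * 0)"
        using l s s' by (intro tendsto_ennrealI tendsto_mult tendsto_const LIMSEQ_realpow_zero)
          (auto simp: powr01_less_one)
      moreover have "n \<in> S" for n using True l c by (simp add: S_def)
      ultimately have "emeasure coin_measure B \<le> ennreal (C * 0)"
        using bound by (intro LIMSEQ_le_const) auto
      then show ?thesis by simp
    next
      case False
      with D0 have "0 < D" by simp
      then obtain n0 where "c * l ^ n0 < D"
        using order_tendstoD(2)[OF lim] by (meson eventually_sequentially order_refl)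
      then have ex: "\<exists>n. n \<notin> S" by (auto simp: S_def intro!: exI[of _ n0])
      define m where "m = (LEAST n. n \<notin> S)"
      have "m \<notin> S" unfolding m_def using ex by (rule LeastI_ex)
      with S0 obtain n where n: "m = Suc n" by (cases m) auto
      then have "n \<in> S" unfolding m_def using not_less_Least[of n "\<lambda>n. n \<notin> S"] by auto
      have "l * c * l ^ n \<le> D" using \<open>m \<notin> S\<close> by (simp add: n S_def algebra_simps)
      then have "(l * c * l ^ n) powr s \<le> D powr s" using l c s by (intro powr_mono2) auto
      moreover have "(l ^ n) powr s = (l powr s) ^ n"
        using l by (induction n) (simp_all add: powr_mult)
      ultimately have "(l * c) powr s * (l powr s) ^ n \<le> D powr s"
        using l c by (simp add: powr_mult)
      then have "(l powr s) ^ n \<le> (l * c) powr - s * D powr s"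
        using l c by (simp add: powr_minus field_simps)
      then have "C * (l powr s) ^ n \<le> C * (l * c) powr - s * D powr s"
        using C0 by (simp add: mult_left_mono mult.assoc)
      with bound[OF \<open>n \<in> S\<close>] have "emeasure coin_measure B \<le> ennreal (C * (l * c) powr - s * D powr s)"
        by (meson ennreal_leI order.trans)
      then show ?thesis using C0 Une s' by (simp add: diam_pow_def ennreal_mult D_def)
    qed
  qed
  then show ?thesis using meas sub by blast
qed

text \<open>
  The mass distribution principle, in the form needed for arbitrary, possibly non-measurable sets: the
  masses of the preimages of the members of a cover add up to at most a constant times the cover sum,
  which can be made arbitrarily small.
\<close>

lemma hausdorff_null_preimage:
  fixes \<phi> :: "(nat \<Rightarrow> bool) \<Rightarrow> 'a::metric_space" and C l c s :: real
  assumes fin: "\<And>n. finite (J n)" and l: "0 < l" "l < 1" and c: "0 < c" and s: "0 \<le> s"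
    and sep: "\<And>n a b i. dist (\<phi> a) (\<phi> b) < c * l ^ n \<Longrightarrow> i \<in> J n \<Longrightarrow> a i = b i"
    and card: "\<And>n. (1/2) ^ card (J n) \<le> C * (l powr s) ^ n"
    and H: "hausdorff_measure s T = 0"
  shows "\<exists>N\<in>null_sets coin_measure. \<phi> -` T \<subseteq> N"
proof -
  define C' where "C' = C * (l * c) powr - s"
  have "0 \<le> C" using card[of 0] by (simp add: order.trans[rotated])
  then have C': "0 \<le> C'" by (simp add: C'_def)
  have "\<exists>B\<in>sets coin_measure. \<phi> -` T \<subseteq> B \<and> emeasure coin_measure B \<le> ennreal e" if e: "e > 0" for e :: real
  proof -
    have "hausdorff_premeasure (c/2) s T \<le> hausdorff_measure s T"
      unfolding hausdorff_measure_def using c by (intro SUP_upper) auto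
    then have "hausdorff_premeasure (c/2) s T < ennreal (e / (C' + 1))"
      using H e C' by (simp add: ennreal_zero_less_divide)
    then obtain U where U: "U \<in> delta_covers (c/2) T"
      and sum: "(\<Sum>i. diam_pow s (U i)) < ennreal (e / (C' + 1))"
      unfolding hausdorff_premeasure_def INF_less_iff by auto
    have "\<exists>B\<in>sets coin_measure. \<phi> -` U i \<subseteq> B \<and> emeasure coin_measure B \<le> ennreal C' * diam_pow s (U i)" for i
    proof -
      have "bounded (U i)" "diameter (U i) \<le> c/2" using U by (auto simp: delta_covers_def)
      then show ?thesis unfolding C'_def using fin l c s sep card
        by (intro mass_of_preimage[where J = J]) auto
    qed
    then obtain B where B: "\<And>i. B i \<in> sets coin_measure" "\<And>i. \<phi> -` U i \<subseteq> B i"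
      "\<And>i. emeasure coin_measure (B i) \<le> ennreal C' * diam_pow s (U i)" by metis
    have "emeasure coin_measure (\<Union>i. B i) \<le> (\<Sum>i. emeasure coin_measure (B i))"
      using B(1) by (intro emeasure_subadditive_countably) auto
    also have "\<dots> \<le> (\<Sum>i. ennreal C' * diam_pow s (U i))"
      using B(3) by (intro suminf_le) auto
    also have "\<dots> = ennreal C' * (\<Sum>i. diam_pow s (U i))" by simp
    also have "\<dots> \<le> ennreal C' * ennreal (e / (C' + 1))"
      using sum by (intro mult_left_mono) auto
    also have "\<dots> = ennreal (C' * (e / (C' + 1)))" using C' e by (intro ennreal_mult[symmetric]) auto
    also have "\<dots> \<le> ennreal e" using C' e by (intro ennreal_leI) (simp add: field_simps)
    finally have "emeasure coin_measure (\<Union>i. B i) \<le> ennreal e" .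
    moreover have "\<phi> -` T \<subseteq> (\<Union>i. B i)"
      using U B(2) by (fastforce simp: delta_covers_def)
    ultimately show ?thesis using B(1) by blast
  qed
  then have "\<exists>B\<in>sets coin_measure. \<phi> -` T \<subseteq> B \<and> emeasure coin_measure B \<le> ennreal (inverse (Suc k))" for k
    by simp
  then obtain B where B: "\<And>k. B k \<in> sets coin_measure" "\<And>k. \<phi> -` T \<subseteq> B k"
    "\<And>k. emeasure coin_measure (B k) \<le> ennreal (inverse (Suc k))" by metis
  have le: "emeasure coin_measure (\<Inter>k. B k) \<le> ennreal (inverse (Suc k))" for k
    using emeasure_mono[OF INT_lower[of k UNIV B] B(1)] B(3)[of k] order.trans by blast
  have "(\<lambda>k. ennreal (inverse (Suc k))) \<longlonglongrightarrow> ennreal 0"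
    by (intro tendsto_ennrealI LIMSEQ_inverse_real_of_nat)
  then have "emeasure coin_measure (\<Inter>k. B k) \<le> ennreal 0"
    using le by (intro LIMSEQ_le_const) auto
  then have "(\<Inter>k. B k) \<in> null_sets coin_measure" using B(1) by (intro null_setsI) auto
  moreover have "\<phi> -` T \<subseteq> (\<Inter>k. B k)" using B(2) by (rule INT_greatest)
  ultimately show ?thesis by blast
qed

section \<open>Coverings, the circle, and the admissible value one\<close>

lemma hausdorff_premeasure_finite_cover:
  fixes A :: "'a::real_normed_vector set" and F :: "'b \<Rightarrow> 'a set"
  assumes "finite X" and cov: "A \<subseteq> (\<Union>x\<in>X. F x)"
    and dist: "\<And>x y z. x \<in> X \<Longrightarrow> y \<in> F x \<Longrightarrow> z \<in> F x \<Longrightarrow> dist y z \<le> D"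
    and "0 \<le> D" "D \<le> \<delta>" and s: "0 < s"
  shows "hausdorff_premeasure \<delta> s A \<le> ennreal (card X * D powr s)"
proof -
  obtain f where f: "bij_betw f {..<card X} X"
    using ex_bij_betw_nat_finite[OF \<open>finite X\<close>] by (auto simp: atLeast0LessThan)
  define U where "U i = (if i < card X then F (f i) else {})" for i
  have fX: "f i \<in> X" if "i < card X" for i using f that by (auto simp: bij_betw_def)
  have b: "bounded (U i)" for i
    using dist[OF fX] unfolding bounded_two_points by (auto simp: U_def intro!: exI[of _ D])
  have d: "diameter (U i) \<le> D" for i
    using dist fX \<open>0 \<le> D\<close> by (intro diameter_le) (auto simp: U_def dist_norm split: if_splits)
  have "A \<subseteq> (\<Union>i. U i)"
  proof
    fix y assume "y \<in> A"
    then obtain x where "x \<in> X" "y \<in> F x" using cov by auto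
    moreover from this f have "x \<in> f ` {..<card X}" by (simp add: bij_betw_imp_surj_on)
    then obtain i where "i < card X" "f i = x" by auto
    ultimately show "y \<in> (\<Union>i. U i)" by (auto simp: U_def intro!: exI[of _ i])
  qed
  then have "U \<in> delta_covers \<delta> A"
    using b d \<open>D \<le> \<delta>\<close> by (auto simp: delta_covers_def intro: order.trans)
  then have "hausdorff_premeasure \<delta> s A \<le> (\<Sum>i. diam_pow s (U i))"
    unfolding hausdorff_premeasure_def by (rule INF_lower)
  also have "\<dots> = (\<Sum>i<card X. diam_pow s (U i))"
    by (intro suminf_finite) (auto simp: U_def diam_pow_def)
  also have "\<dots> \<le> (\<Sum>i<card X. ennreal (D powr s))"
  proof (intro sum_mono)
    fix i
    have "diameter (U i) powr s \<le> D powr s"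
      using d b s by (intro powr_mono2) (auto intro: diameter_ge_0)
    then show "diam_pow s (U i) \<le> ennreal (D powr s)"
      using s by (auto simp: diam_pow_def ennreal_leI)
  qed
  also have "\<dots> = ennreal (card X * D powr s)" by (simp add: ennreal_mult ennreal_of_nat_eq_real_of_nat)
  finally show ?thesis .
qed

definition pt :: "real \<Rightarrow> real \<Rightarrow> real^2" where
  "pt x y = (\<chi> i. if i = 1 then x else y)"

lemma pt_nth [simp]: "pt x y $ 1 = x" "pt x y $ 2 = y"
  by (simp_all add: pt_def)

lemma dist_pt:
  "\<bar>x - x'\<bar> \<le> dist (pt x y) (pt x' y')" "\<bar>y - y'\<bar> \<le> dist (pt x y) (pt x' y')"
  "dist (pt x y) (pt x' y') \<le> \<bar>x - x'\<bar> + \<bar>y - y'\<bar>"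
  using component_le_norm_cart[of "pt x y - pt x' y'" 1] component_le_norm_cart[of "pt x y - pt x' y'" 2]
    norm_le_l1_cart[of "pt x y - pt x' y'"]
  by (simp_all add: dist_norm sum_2)

text \<open>
  The circle is covered by \<open>N\<close> arcs of diameter at most \<open>4 * pi / N\<close>, and \<open>N * (1 / N) powr s\<close> tends
  to zero for \<open>s > 1\<close>.
\<close>

lemma hausdorff_measure_circle:
  assumes "1 < s"
  shows "hausdorff_measure s unit_circle = 0"
proof -
  define w where "w \<theta> = pt (cos \<theta>) (sin \<theta>)" for \<theta>
  have w: "dist (w x) (w y) \<le> 2 * \<bar>x - y\<bar>" for x y
  proof -
    have "\<bar>cos x - cos y\<bar> = 2 * \<bar>sin ((x + y) / 2)\<bar> * \<bar>sin ((y - x) / 2)\<bar>"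
      by (simp add: cos_diff_cos abs_mult)
    also have "\<dots> \<le> 2 * 1 * \<bar>(y - x) / 2\<bar>"
      by (intro mult_mono abs_sin_x_le_abs_x) auto
    finally have "\<bar>cos x - cos y\<bar> \<le> \<bar>x - y\<bar>" by simp
    moreover have "\<bar>sin x - sin y\<bar> \<le> \<bar>x - y\<bar>"
    proof -
      have "\<bar>sin x - sin y\<bar> = 2 * \<bar>sin ((x - y) / 2)\<bar> * \<bar>cos ((x + y) / 2)\<bar>"
        by (simp add: sin_diff_sin abs_mult)
      also have "\<dots> \<le> 2 * \<bar>(x - y) / 2\<bar> * 1"
        by (intro mult_mono abs_sin_x_le_abs_x) auto
      finally show ?thesis by simp
    qed
    ultimately have "\<bar>cos x - cos y\<bar> + \<bar>sin x - sin y\<bar> \<le> 2 * \<bar>x - y\<bar>"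
      unfolding mult_2 by (rule add_mono)
    with dist_pt(3) show ?thesis unfolding w_def by (rule order.trans)
  qed
  have "hausdorff_premeasure \<delta> s unit_circle \<le> 0" if \<delta>: "0 < \<delta>" for \<delta>
  proof -
    have bound: "hausdorff_premeasure \<delta> s unit_circle \<le> ennreal ((4 * pi) powr s * real N powr (1 - s))"
      if N: "0 < N" "4 * pi / N \<le> \<delta>" for N :: nat
    proof -
      define F where "F k = w ` {2 * pi * k / N .. 2 * pi * (k + 1) / N}" for k :: nat
      have "unit_circle \<subseteq> (\<Union>k\<in>{..<N}. F k)"
      proof
        fix x :: "real^2" assume "x \<in> unit_circle"
        then have "(x $ 1)\<^sup>2 + (x $ 2)\<^sup>2 = 1"
          by (simp add: unit_circle_def norm_eq_1 inner_vec_def sum_2 power2_eq_square)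
        then obtain \<theta> where \<theta>: "0 \<le> \<theta>" "\<theta> < 2 * pi" "x $ 1 = cos \<theta>" "x $ 2 = sin \<theta>"
          using sincos_total_2pi by metis
        then have x: "x = w \<theta>" by (simp add: w_def vec_eq_iff forall_2)
        define k where "k = nat \<lfloor>\<theta> * N / (2 * pi)\<rfloor>"
        have nonneg: "0 \<le> \<theta> * N / (2 * pi)" using \<theta> by simp
        then have k: "real k = of_int \<lfloor>\<theta> * N / (2 * pi)\<rfloor>" by (simp add: k_def)
        have "real k \<le> \<theta> * N / (2 * pi)" "\<theta> * N / (2 * pi) \<le> real k + 1"
          unfolding k by linarith+
        then have "\<theta> \<in> {2 * pi * k / N .. 2 * pi * (k + 1) / N}"
          using N by (simp add: field_simps)
        moreover have "k < N"
        proof -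
          have "\<theta> * N / (2 * pi) < N" using \<theta> N by (simp add: field_simps)
          with \<open>real k \<le> \<theta> * N / (2 * pi)\<close> show ?thesis by linarith
        qed
        ultimately show "x \<in> (\<Union>k\<in>{..<N}. F k)" unfolding x F_def by blast
      qed
      moreover have "dist y z \<le> 4 * pi / N" if yz: "y \<in> F k" "z \<in> F k" for y z k
      proof -
        obtain \<alpha> \<beta> where \<alpha>\<beta>: "y = w \<alpha>" "z = w \<beta>"
          "\<alpha> \<in> {2 * pi * k / N .. 2 * pi * (k + 1) / N}" "\<beta> \<in> {2 * pi * k / N .. 2 * pi * (k + 1) / N}"
          using yz unfolding F_def by blast
        have "2 * pi * (k + 1) / N = 2 * pi * k / N + 2 * pi / N"
          by (simp add: add_divide_distrib algebra_simps)
        then have "\<bar>\<alpha> - \<beta>\<bar> \<le> 2 * pi / N" using \<alpha>\<beta> by auto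
        then show ?thesis using w[of \<alpha> \<beta>] \<alpha>\<beta> by simp
      qed
      ultimately have "hausdorff_premeasure \<delta> s unit_circle \<le> ennreal (card {..<N} * (4 * pi / N) powr s)"
        using N assms by (intro hausdorff_premeasure_finite_cover) auto
      also have "card {..<N} * (4 * pi / N) powr s = (4 * pi) powr s * real N powr (1 - s)"
        using N by (simp add: powr_divide powr_diff field_simps)
      finally show ?thesis .
    qed
    have "(\<lambda>N. (4 * pi) powr s * real N powr (1 - s)) \<longlonglongrightarrow> (4 * pi) powr s * 0"
      using assms by (intro tendsto_mult tendsto_const tendsto_neg_powr filterlim_real_sequentially) auto
    then have "(\<lambda>N. ennreal ((4 * pi) powr s * real N powr (1 - s))) \<longlonglongrightarrow> 0"
      using tendsto_ennrealI by fastforce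
    moreover have "\<exists>M. \<forall>N\<ge>M. hausdorff_premeasure \<delta> s unit_circle \<le> ennreal ((4 * pi) powr s * real N powr (1 - s))"
    proof (intro exI[of _ "Suc (nat \<lceil>4 * pi / \<delta>\<rceil>)"] allI impI bound)
      fix N assume "Suc (nat \<lceil>4 * pi / \<delta>\<rceil>) \<le> N"
      then have "4 * pi / \<delta> \<le> N" "0 < N" by linarith+
      then show "0 < N" "4 * pi / N \<le> \<delta>" using \<delta> by (auto simp: field_simps)
    qed
    ultimately show ?thesis by (rule LIMSEQ_le_const)
  qed
  then show ?thesis by (simp add: hausdorff_measure_def SUP_eq_const)
qed

lemma hausdorff_dim_circle: "hausdorff_dim unit_circle \<le> 1"
proof (rule ennreal_le_epsilon)
  fix e :: real assume "0 < e"
  then have "hausdorff_dim unit_circle \<le> ennreal (1 + e)"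
    unfolding hausdorff_dim_def by (intro INF_lower) (simp add: hausdorff_measure_circle)
  then show "hausdorff_dim unit_circle \<le> 1 + ennreal e" using \<open>0 < e\<close> by (simp add: ennreal_plus)
qed

lemma gamma_admissible_1: "gamma_admissible t 1"
  unfolding gamma_admissible_def
proof (intro allI impI exI[of _ unit_circle] conjI)
  fix K :: "(real^2) set"
  have "hausdorff_premeasure \<delta> t ({} :: (real^2) set) \<le> 0" if "0 < \<delta>" for \<delta>
  proof -
    have "(\<lambda>_. {}) \<in> delta_covers \<delta> ({} :: (real^2) set)" using that by (simp add: delta_covers_def)
    then have "hausdorff_premeasure \<delta> t ({} :: (real^2) set) \<le> (\<Sum>i::nat. diam_pow t ({} :: (real^2) set))"
      unfolding hausdorff_premeasure_def by (rule INF_lower)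
    then show ?thesis by (simp add: diam_pow_def)
  qed
  then have "hausdorff_measure t ({} :: (real^2) set) = 0" by (simp add: hausdorff_measure_def SUP_eq_const)
  then show "hausdorff_ae_in t K (\<lambda>x. \<forall>e\<in>unit_circle - unit_circle. at_least_two (K \<inter> line_through x e))"
    by (simp add: hausdorff_ae_in_def)
qed (use hausdorff_dim_circle in auto)

section \<open>Homogeneous Cantor sets on the line\<close>

definition cantor_value :: "real \<Rightarrow> (nat \<Rightarrow> bool) \<Rightarrow> real" where
  "cantor_value l a = (\<Sum>i. of_bool (a i) * l ^ i)"

lemma cantor_value_summable:
  assumes "0 \<le> l" "l < 1"
  shows "summable (\<lambda>i. of_bool (a i) * l ^ i :: real)"
  using assms by (intro summable_comparison_test'[OF summable_geometric[of l]]) auto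

lemma cantor_value_bounds:
  assumes "0 \<le> l" "l < 1"
  shows "0 \<le> cantor_value l a" "cantor_value l a \<le> 1 / (1 - l)"
proof -
  show "0 \<le> cantor_value l a"
    unfolding cantor_value_def using assms by (intro suminf_nonneg cantor_value_summable) auto
  have "cantor_value l a \<le> (\<Sum>i. l ^ i)"
    unfolding cantor_value_def using assms by (intro suminf_le cantor_value_summable summable_geometric) auto
  then show "cantor_value l a \<le> 1 / (1 - l)" using assms by (simp add: suminf_geometric)
qed

lemma cantor_value_le_2:
  assumes "0 < l" "l < 1/2"
  shows "0 \<le> cantor_value l a" "cantor_value l a \<le> 2"
proof -
  have "1 / (1 - l) \<le> 2" using assms by (simp add: field_simps)
  then show "0 \<le> cantor_value l a" "cantor_value l a \<le> 2" using cantor_value_bounds[of l a] assms by auto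
qed

lemma cantor_value_diff_shift:
  assumes l: "0 \<le> l" "l < 1" and agree: "\<And>i. i < n \<Longrightarrow> a i = b i"
  shows "cantor_value l a - cantor_value l b = l ^ n * (cantor_value l (\<lambda>i. a (i + n)) - cantor_value l (\<lambda>i. b (i + n)))"
proof -
  have split: "cantor_value l c = l ^ n * cantor_value l (\<lambda>i. c (i + n)) + (\<Sum>i<n. of_bool (c i) * l ^ i)" for c
  proof -
    have "(\<Sum>i. of_bool (c (i + n)) * l ^ (i + n)) = l ^ n * cantor_value l (\<lambda>i. c (i + n))"
      unfolding cantor_value_def suminf_mult[OF cantor_value_summable[OF l], symmetric] by (simp add: power_add algebra_simps)
    then show ?thesis
      using suminf_split_initial_segment[OF cantor_value_summable[OF l], of c n] by (simp add: cantor_value_def)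
  qed
  show ?thesis using agree by (simp add: split[of a] split[of b] algebra_simps)
qed

lemma cantor_value_close:
  assumes l: "0 \<le> l" "l < 1" and agree: "\<And>i. i < n \<Longrightarrow> a i = b i"
  shows "\<bar>cantor_value l a - cantor_value l b\<bar> \<le> 1 / (1 - l) * l ^ n"
proof -
  let ?x = "cantor_value l (\<lambda>i. a (i + n))" and ?y = "cantor_value l (\<lambda>i. b (i + n))"
  have "\<bar>?x - ?y\<bar> \<le> 1 / (1 - l)"
    using cantor_value_bounds[OF l, of "\<lambda>i. a (i + n)"] cantor_value_bounds[OF l, of "\<lambda>i. b (i + n)"] by linarith
  then have "l ^ n * \<bar>?x - ?y\<bar> \<le> l ^ n * (1 / (1 - l))"
    using l by (intro mult_left_mono) auto
  then show ?thesis
    using l by (simp add: cantor_value_diff_shift[OF l agree] abs_mult)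
qed

text \<open>
  At the first index \<open>k\<close> where \<open>a\<close> and \<open>b\<close> differ, the digit contributes \<open>l ^ k\<close> to the difference,
  while all later digits together contribute at most \<open>l ^ (k + 1) / (1 - l)\<close>. The condition
  \<open>l < 1/2\<close> makes the former win; this gap is what separates the points of the Cantor set.
\<close>

lemma cantor_value_separated:
  assumes l: "0 < l" "l < 1/2"
    and close: "\<bar>cantor_value l a - cantor_value l b\<bar> < (1 - 2 * l) / (1 - l) * l ^ n"
    and "i \<le> n"
  shows "a i = b i"
proof (rule ccontr)
  assume "a i \<noteq> b i"
  define k where "k = (LEAST k. a k \<noteq> b k)"
  have k: "a k \<noteq> b k" unfolding k_def by (rule LeastI) fact
  have "k \<le> i" unfolding k_def by (rule Least_le) fact
  have below: "a j = b j" if "j < k" for j using not_less_Least that unfolding k_def by blast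
  have l': "0 \<le> l" "l < 1" using l by auto
  define x y where "x = cantor_value l (\<lambda>i. a (i + Suc k))" and "y = cantor_value l (\<lambda>i. b (i + Suc k))"
  have xy: "\<bar>x - y\<bar> \<le> 1 / (1 - l)"
    using cantor_value_bounds[OF l', of "\<lambda>i. a (i + Suc k)"] cantor_value_bounds[OF l', of "\<lambda>i. b (i + Suc k)"]
    unfolding x_def y_def by linarith
  have step: "cantor_value l c = of_bool (c 0) + l * cantor_value l (\<lambda>i. c (i + 1))" for c
  proof -
    have "(\<Sum>i. of_bool (c (Suc i)) * l ^ (Suc i)) = l * cantor_value l (\<lambda>i. c (i + 1))"
      unfolding cantor_value_def suminf_mult[OF cantor_value_summable[OF l'], symmetric] by (simp add: algebra_simps)
    then show ?thesis
      using suminf_split_head[OF cantor_value_summable[OF l'], of c] by (simp add: cantor_value_def)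
  qed
  have "cantor_value l a - cantor_value l b = l ^ k * (of_bool (a k) - of_bool (b k) + l * (x - y))"
    using cantor_value_diff_shift[OF l', of k a b, OF below] step[of "\<lambda>i. a (i + k)"] step[of "\<lambda>i. b (i + k)"]
    by (simp add: x_def y_def algebra_simps)
  moreover have "\<bar>of_bool (a k) - of_bool (b k) + l * (x - y)\<bar> \<ge> (1 - 2 * l) / (1 - l)"
  proof -
    have "\<bar>of_bool (a k) - of_bool (b k) :: real\<bar> = 1" using k by auto
    moreover have "\<bar>l * (x - y)\<bar> \<le> l * (1 / (1 - l))"
      using l xy by (simp only: abs_mult) (intro mult_mono, auto)
    moreover have "1 - l * (1 / (1 - l)) = (1 - 2 * l) / (1 - l)" using l by (simp add: field_simps)
    ultimately show ?thesis by linarith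
  qed
  ultimately have "l ^ k * ((1 - 2 * l) / (1 - l)) \<le> \<bar>cantor_value l a - cantor_value l b\<bar>"
    using l by (simp only: abs_mult) (intro mult_mono, auto)
  moreover have "l ^ n * ((1 - 2 * l) / (1 - l)) \<le> l ^ k * ((1 - 2 * l) / (1 - l))"
    using l \<open>k \<le> i\<close> \<open>i \<le> n\<close> by (intro mult_right_mono power_decreasing) auto
  ultimately show False using close by (simp add: mult.commute)
qed

lemma cantor_value_inject:
  assumes l: "0 < l" "l < 1/2" and eq: "cantor_value l a = cantor_value l b"
  shows "a = b"
proof
  fix i show "a i = b i"
    using l eq by (intro cantor_value_separated[of l a b i i]) auto
qed

lemma continuous_cantor_value:
  assumes "0 \<le> l" "l < 1"
  shows "continuous_on UNIV (cantor_value l)"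
proof -
  have "uniform_limit UNIV (\<lambda>n a. \<Sum>i<n. of_bool (a i) * l ^ i)
          (\<lambda>a. \<Sum>i. of_bool (a i) * l ^ i) sequentially"
    using assms by (intro Weierstrass_m_test[where M = "\<lambda>i. l ^ i"] summable_geometric) auto
  moreover have "continuous_on UNIV (\<lambda>a :: nat \<Rightarrow> bool. of_bool (a i) :: real)" for i
  proof -
    have "continuous_on UNIV (of_bool :: bool \<Rightarrow> real)" 
      by (simp add: continuous_on_open_invariant open_discrete)
    from continuous_on_compose2[OF this continuous_on_product_coordinates[of i]]
    show ?thesis by (auto intro: continuous_on_subset)
  qed
  ultimately show ?thesis
    unfolding cantor_value_def
    by (intro uniform_limit_theorem[where F = sequentially and f = "\<lambda>n a. \<Sum>i<n. of_bool (a i) * l ^ i"])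
       (auto intro!: always_eventually continuous_on_sum continuous_on_mult_right simp del: sum_of_bool_mult_eq)
qed

lemma compact_UNIV_cantor: "compact (UNIV :: (nat \<Rightarrow> bool) set)"
proof -
  have "compact_space (euclidean :: bool topology)"
    by (simp add: compact_space_def finite_imp_compact)
  then have "compact_space (product_topology (\<lambda>_::nat. euclidean :: bool topology) UNIV)"
    by (simp add: compact_space_product_topology)
  then show ?thesis unfolding euclidean_product_topology compact_space_def by simp
qed

section \<open>Reading off a subsequence of the digits\<close>

text \<open>
  For \<open>r\<close> between \<open>0\<close> and \<open>1\<close> the positions \<open>\<lfloor>j / r\<rfloor>\<close> form a subset of density \<open>r\<close>
  of the natural numbers. A coin sequence read along it has its first \<open>n\<close> digits at positions
  of which a proportion of about \<open>r\<close> lies below \<open>n\<close>; \<open>digit_set r n\<close> collects these positions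
  together with the first \<open>n\<close> ones.
\<close>

definition digit_pos :: "real \<Rightarrow> nat \<Rightarrow> nat" where
  "digit_pos r j = nat \<lfloor>j / r\<rfloor>"

definition digit_set :: "real \<Rightarrow> nat \<Rightarrow> nat set" where
  "digit_set r n = {..<n} \<union> digit_pos r ` {..<n}"

lemma finite_digit_set: "finite (digit_set r n)" by (simp add: digit_set_def)

text \<open>
  Since \<open>\<lfloor>j / r\<rfloor> < n\<close> is equivalent to \<open>j < r * n\<close>, exactly \<open>\<lceil>r * n\<rceil>\<close> of the \<open>n\<close> subsequence positions
  are already among the first \<open>n\<close> positions, and the others are new.
\<close>

lemma card_digit_set:
  fixes r :: real
  assumes r: "0 < r" "r < 1"
  shows "card (digit_set r n) = 2 * n - nat \<lceil>r * n\<rceil>" "nat \<lceil>r * n\<rceil> \<le> n"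
proof -
  have less: "digit_pos r j < n \<longleftrightarrow> j < nat \<lceil>r * n\<rceil>" for j n
  proof -
    have "digit_pos r j < n \<longleftrightarrow> real j / r < n"
    proof -
      have "0 \<le> real j / r" using r by simp
      then have "0 \<le> \<lfloor>real j / r\<rfloor>" by simp
      then show ?thesis by (simp add: digit_pos_def nat_less_iff floor_less_iff)
    qed
    also have "\<dots> \<longleftrightarrow> real j < r * n" using r by (simp add: field_simps)
    also have "\<dots> \<longleftrightarrow> j < nat \<lceil>r * n\<rceil>" by (simp add: zless_nat_eq_int_zless less_ceiling_iff)
    finally show ?thesis .
  qed
  have inj: "inj (digit_pos r)"
  proof (rule strict_mono_imp_inj_on, rule strict_mono_Suc_iff[THEN iffD2], rule allI)
    fix j
    have "real j / r + 1 \<le> real (Suc j) / r" using r by (simp add: field_simps)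
    then have "\<lfloor>real j / r + 1\<rfloor> \<le> \<lfloor>real (Suc j) / r\<rfloor>" by (rule floor_mono)
    then have "\<lfloor>real j / r\<rfloor> + 1 \<le> \<lfloor>real (Suc j) / r\<rfloor>" by simp
    moreover have "0 \<le> \<lfloor>real j / r\<rfloor>" using r by simp
    ultimately show "digit_pos r j < digit_pos r (Suc j)" unfolding digit_pos_def by linarith
  qed
  have "r * real n \<le> 1 * real n" using r by (intro mult_right_mono) auto
  then show le: "nat \<lceil>r * n\<rceil> \<le> n" by (simp add: ceiling_le_iff)
  have "digit_set r n = {..<n} \<union> digit_pos r ` {nat \<lceil>r * n\<rceil>..<n}"
  proof -
    have "digit_pos r j \<in> {..<n} \<union> digit_pos r ` {nat \<lceil>r * n\<rceil>..<n}" if "j < n" for j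
    proof (cases "digit_pos r j < n")
      case False
      then have "j \<in> {nat \<lceil>r * n\<rceil>..<n}"
        using less[of j n] that by (simp only: atLeastLessThan_iff not_less)
      then show ?thesis by blast
    qed simp
    then show ?thesis by (auto simp: digit_set_def)
  qed
  moreover have "{..<n} \<inter> digit_pos r ` {nat \<lceil>r * n\<rceil>..<n} = {}"
    using less by (auto simp: not_less[symmetric])
  ultimately have "card (digit_set r n) = n + card (digit_pos r ` {nat \<lceil>r * n\<rceil>..<n})"
    by (simp add: card_Un_disjoint)
  also have "card (digit_pos r ` {nat \<lceil>r * n\<rceil>..<n}) = n - nat \<lceil>r * n\<rceil>"
    using inj by (subst card_image) (auto intro: inj_on_subset)
  finally show "card (digit_set r n) = 2 * n - nat \<lceil>r * n\<rceil>" using le by simp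
qed

lemma card_digit_set_bounds:
  fixes r :: real
  assumes r: "0 < r" "r < 1"
  shows "(2 - r) * n - 1 \<le> card (digit_set r n)" "card (digit_set r n) \<le> (2 - r) * n"
proof -
  have "0 \<le> r * n" using r by simp
  then have "real (nat \<lceil>r * n\<rceil>) = of_int \<lceil>r * n\<rceil>" by simp
  then have "r * n \<le> nat \<lceil>r * n\<rceil>" "nat \<lceil>r * n\<rceil> \<le> r * n + 1" by linarith+
  moreover have "real (card (digit_set r n)) = 2 * real n - real (nat \<lceil>r * n\<rceil>)"
    unfolding card_digit_set(1)[OF r] using card_digit_set(2)[OF r, of n] by (subst of_nat_diff) auto
  ultimately have "2 * real n - r * n - 1 \<le> card (digit_set r n)" "card (digit_set r n) \<le> 2 * real n - r * n"
    by linarith+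
  then show "(2 - r) * n - 1 \<le> card (digit_set r n)" "card (digit_set r n) \<le> (2 - r) * n"
    by (simp_all only: left_diff_distrib)
qed

section \<open>The radial graph\<close>

text \<open>
  The unit vector along the line \<open>X = u * (1 + Y)\<close> through the pole \<open>(0, -1)\<close>.
\<close>

definition ray_dir :: "real \<Rightarrow> real^2" where
  "ray_dir u = pt (u / sqrt (u\<^sup>2 + 1)) (1 / sqrt (u\<^sup>2 + 1))"

lemma ray_dir_circle: "ray_dir u \<in> unit_circle"
proof -
  have "(u / sqrt (u\<^sup>2 + 1))\<^sup>2 + (1 / sqrt (u\<^sup>2 + 1))\<^sup>2 = 1"
    by (simp add: power_divide add_nonneg_eq_0_iff flip: add_divide_distrib)
  then show ?thesis
    by (simp add: ray_dir_def unit_circle_def norm_eq_1 inner_vec_def sum_2 power2_eq_square)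
qed

text \<open>
  The slope is recovered from the unit vector as a quotient of its coordinates, whose denominator
  \<open>1 / sqrt (u\<^sup>2 + 1)\<close> stays above \<open>1/3\<close>. Hence separated slopes have separated directions.
\<close>

lemma ray_dir_expands:
  assumes u: "0 \<le> u" "u \<le> 2" and v: "0 \<le> v" "v \<le> 2"
  shows "\<bar>u - v\<bar> \<le> 9 * dist (ray_dir u) (ray_dir v)"
proof -
  define m n where "m = sqrt (u\<^sup>2 + 1)" and "n = sqrt (v\<^sup>2 + 1)"
  have "u\<^sup>2 \<le> 2\<^sup>2" using u by (intro power_mono) auto
  then have m: "0 < m" "m \<le> 3" unfolding m_def by (auto intro!: real_le_lsqrt add_nonneg_pos)
  have n: "0 < n" unfolding n_def by (auto intro!: add_nonneg_pos)
  define \<delta> where "\<delta> = dist (ray_dir u) (ray_dir v)"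
  have x: "\<bar>u / m - v / n\<bar> \<le> \<delta>" and y: "\<bar>1 / m - 1 / n\<bar> \<le> \<delta>"
    unfolding \<delta>_def ray_dir_def m_def n_def by (rule dist_pt)+
  have "u - v = m * (u / m - v / n) - v * m * (1 / m - 1 / n)"
    using m n by (simp add: field_simps)
  then have "\<bar>u - v\<bar> \<le> \<bar>m * (u / m - v / n)\<bar> + \<bar>v * m * (1 / m - 1 / n)\<bar>"
    by (simp only: abs_triangle_ineq4)
  moreover have "\<bar>m * (u / m - v / n)\<bar> \<le> 3 * \<delta>"
    unfolding abs_mult using x m by (intro mult_mono) auto
  moreover have "\<bar>v * m * (1 / m - 1 / n)\<bar> \<le> 2 * 3 * \<delta>"
    unfolding abs_mult using y m v by (intro mult_mono) auto
  ultimately show ?thesis unfolding \<delta>_def[symmetric] by linarith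
qed

text \<open>
  The point at height \<open>y\<close> on the line \<open>X = u * (1 + Y)\<close>, where \<open>u\<close> is the Cantor value of \<open>a\<close> and \<open>y\<close>
  that of the subsequence of \<open>a\<close>. The heights are nonnegative, hence bounded away from the pole at
  height \<open>-1\<close>, and the polar coordinates \<open>(u, y)\<close> are bilipschitz on the range.
\<close>

definition radial :: "real \<Rightarrow> real \<Rightarrow> (nat \<Rightarrow> bool) \<Rightarrow> real^2" where
  "radial l r a = pt (cantor_value l a * (1 + cantor_value l (a \<circ> digit_pos r))) (cantor_value l (a \<circ> digit_pos r))"

lemma compact_radial:
  assumes l: "0 < l" "l < 1/2"
  shows "compact (range (radial l r))"
proof (rule compact_continuous_image[OF _ compact_UNIV_cantor])
  have v: "continuous_on UNIV (cantor_value l)" using l by (intro continuous_cantor_value) auto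
  have "continuous_on UNIV (\<lambda>a :: nat \<Rightarrow> bool. a \<circ> digit_pos r)"
    unfolding comp_def by (intro continuous_on_coordinatewise_then_product continuous_on_product_coordinates)
  then have y: "continuous_on UNIV (\<lambda>a. cantor_value l (a \<circ> digit_pos r))"
    by (rule continuous_on_compose2[OF v]) auto
  show "continuous_on UNIV (radial l r)"
    unfolding radial_def pt_def
  proof (intro continuous_on_vec_lambda)
    fix i :: 2
    show "continuous_on UNIV (\<lambda>a. if i = 1 then cantor_value l a * (1 + cantor_value l (a \<circ> digit_pos r)) else cantor_value l (a \<circ> digit_pos r))"
      using v y by (cases "i = 1") (auto intro!: continuous_intros)
  qed
qed

lemma radial_separated:
  assumes l: "0 < l" "l < 1/2"
    and close: "dist (radial l r a) (radial l r b) < (1 - 2 * l) / (1 - l) / 3 * l ^ n"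
    and i: "i \<in> digit_set r n"
  shows "a i = b i"
proof -
  define u v x y where "u = cantor_value l a" and "v = cantor_value l b"
    and "x = cantor_value l (a \<circ> digit_pos r)" and "y = cantor_value l (b \<circ> digit_pos r)"
  define \<delta> where "\<delta> = dist (radial l r a) (radial l r b)"
  have 1: "\<bar>u * (1 + x) - v * (1 + y)\<bar> \<le> \<delta>" and 2: "\<bar>x - y\<bar> \<le> \<delta>"
    unfolding \<delta>_def radial_def u_def v_def x_def y_def by (rule dist_pt)+
  have b: "0 \<le> x" "0 \<le> v" "v \<le> 2" unfolding x_def v_def using cantor_value_le_2[OF l] by auto
  have "(u - v) * (1 + x) = (u * (1 + x) - v * (1 + y)) - v * (x - y)" by (simp add: algebra_simps)
  moreover have "\<bar>v * (x - y)\<bar> \<le> 2 * \<delta>" unfolding abs_mult using b 2 by (intro mult_mono) auto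
  ultimately have "\<bar>(u - v) * (1 + x)\<bar> \<le> 3 * \<delta>" using 1 by linarith
  moreover have "\<bar>u - v\<bar> * 1 \<le> \<bar>u - v\<bar> * (1 + x)" using b by (intro mult_left_mono) auto
  ultimately have uv: "\<bar>u - v\<bar> \<le> 3 * \<delta>" using b by (simp add: abs_mult)
  have \<delta>: "3 * \<delta> < (1 - 2 * l) / (1 - l) * l ^ n" 
  proof -
    have "(1 - 2 * l) / (1 - l) / 3 * l ^ n = (1 - 2 * l) / (1 - l) * l ^ n / 3" by simp
    moreover have "3 * p < q" if "p < q / 3" for p q :: real using that by simp
    ultimately show ?thesis using close unfolding \<delta>_def by metis
  qed
  have "0 \<le> \<delta>" by (simp add: \<delta>_def)
  show ?thesis
  proof (cases "i < n")
    case True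
    then show ?thesis using cantor_value_separated[OF l, of a b n i] uv \<delta> by (simp add: u_def v_def)
  next
    case False
    with i obtain j where j: "j < n" "i = digit_pos r j" by (auto simp: digit_set_def)
    have "(a \<circ> digit_pos r) j = (b \<circ> digit_pos r) j"
      using cantor_value_separated[OF l, of "a \<circ> digit_pos r" "b \<circ> digit_pos r" n j] 2 \<delta> \<open>0 \<le> \<delta>\<close> j
      by (simp add: x_def y_def)
    then show ?thesis using j by simp
  qed
qed

lemma radial_close:
  assumes l: "0 < l" "l < 1/2" and agree: "\<And>i. i \<in> digit_set r n \<Longrightarrow> a i = b i"
  shows "dist (radial l r a) (radial l r b) \<le> 12 * l ^ n"
proof -
  define u v x y where "u = cantor_value l a" and "v = cantor_value l b"
    and "x = cantor_value l (a \<circ> digit_pos r)" and "y = cantor_value l (b \<circ> digit_pos r)"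
  have "1 / (1 - l) \<le> 2" using l by (simp add: field_simps)
  then have K: "1 / (1 - l) * l ^ n \<le> 2 * l ^ n" using l by (intro mult_right_mono) auto
  have uv: "\<bar>u - v\<bar> \<le> 2 * l ^ n"
    using cantor_value_close[of l n a b] l agree K unfolding u_def v_def digit_set_def by fastforce
  have xy: "\<bar>x - y\<bar> \<le> 2 * l ^ n"
    using cantor_value_close[of l n "a \<circ> digit_pos r" "b \<circ> digit_pos r"] l agree K
    unfolding x_def y_def digit_set_def by fastforce
  have b: "0 \<le> x" "x \<le> 2" "0 \<le> v" "v \<le> 2" unfolding x_def v_def using cantor_value_le_2[OF l] by auto
  have "u * (1 + x) - v * (1 + y) = (u - v) * (1 + x) + v * (x - y)" by (simp add: algebra_simps)
  moreover have "\<bar>(u - v) * (1 + x)\<bar> \<le> (2 * l ^ n) * 3"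
    unfolding abs_mult using uv b l by (intro mult_mono) auto
  moreover have "\<bar>v * (x - y)\<bar> \<le> 2 * (2 * l ^ n)"
    unfolding abs_mult using xy b l by (intro mult_mono) auto
  ultimately have "\<bar>u * (1 + x) - v * (1 + y)\<bar> \<le> 10 * l ^ n" by linarith
  then show ?thesis
    using xy dist_pt(3)[of "u * (1 + x)" x "v * (1 + y)" y]
    unfolding radial_def u_def v_def x_def y_def by linarith
qed

text \<open>
  A line through the pole fixes \<open>u\<close>, and \<open>u\<close> determines the whole sequence; so it meets the radial graph
  in at most one point.
\<close>

lemma radial_line:
  assumes l: "0 < l" "l < 1/2"
  shows "range (radial l r) \<inter> line_through (radial l r a) (ray_dir (cantor_value l a)) \<subseteq> {radial l r a}"
proof safe
  fix b assume "radial l r b \<in> line_through (radial l r a) (ray_dir (cantor_value l a))"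
  define u v x y where "u = cantor_value l a" and "v = cantor_value l b"
    and "x = cantor_value l (a \<circ> digit_pos r)" and "y = cantor_value l (b \<circ> digit_pos r)"
  obtain c where c: "radial l r b = radial l r a + c *\<^sub>R ray_dir (cantor_value l a)"
    using \<open>radial l r b \<in> _\<close> by (auto simp: line_through_def span_singleton)
  define k where "k = c / sqrt (u\<^sup>2 + 1)"
  have "v * (1 + y) = u * (1 + x) + k * u" "y = x + k"
    using arg_cong[OF c, of "\<lambda>z. z $ 1"] arg_cong[OF c, of "\<lambda>z. z $ 2"]
    by (simp_all add: radial_def ray_dir_def u_def v_def x_def y_def k_def)
  then have "(v - u) * (1 + y) = 0" by (simp add: algebra_simps)
  moreover have "0 \<le> y" unfolding y_def using cantor_value_le_2[OF l] by auto
  ultimately have "v = u" by simp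
  then have "b = a" using cantor_value_inject[OF l] by (simp add: u_def v_def)
  then show "radial l r b = radial l r a" by simp
qed

section \<open>The value of the exponent\<close>

text \<open>
  The dimension \<open>d\<close> of the set of slopes is below \<open>1\<close> to keep the digits separated, and above \<open>\<gamma>\<close> so that
  sets of dimension at most \<open>\<gamma>\<close> carry no mass. The condition \<open>t / 2 < d\<close> leaves a positive density \<open>r = 2 - t / d\<close> for the digit positions.
\<close>

lemma not_gamma_admissible:
  assumes t: "1 < t" "t < 2" and \<gamma>: "0 \<le> \<gamma>" "\<gamma> < 1"
  shows "\<not> gamma_admissible t \<gamma>"
proof
  assume adm: "gamma_admissible t \<gamma>"
  obtain d where d: "max \<gamma> (t / 2) < d" "d < 1" using dense[of "max \<gamma> (t / 2)" 1] t \<gamma> by auto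
  then have d0: "0 < d" "\<gamma> < d" "t / d < 2" "1 < t / d" using t by (auto simp: field_simps)
  define l where "l = 2 powr (- 1 / d)"
  define r where "r = 2 - t / d"
  have r: "0 < r" "r < 1" using d0 by (auto simp: r_def)
  have "2 powr (- 1 / d) < 2 powr (- 1)" using d d0 by (intro powr_less_mono) (auto simp: field_simps)
  then have l: "0 < l" "l < 1/2" by (auto simp: l_def powr_minus)
  have lpow: "l powr s = 2 powr (- s / d)" for s by (simp add: l_def powr_powr)
  let ?J = "digit_set r"
  have lt: "(l powr t) ^ n = 2 powr (- (2 - r) * n)" for n
    by (simp add: lpow r_def powr_power mult.commute)
  define K where "K = range (radial l r)"
  have "compact K" unfolding K_def using l by (rule compact_radial)
  moreover have "hausdorff_measure t K \<le> ennreal (12 powr t)"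
    unfolding hausdorff_measure_def
  proof (rule SUP_least)
    fix \<delta> :: real assume "\<delta> \<in> {0<..}"
    moreover have "(\<lambda>n. 12 * l ^ n) \<longlonglongrightarrow> 12 * 0"
      using l by (intro tendsto_mult tendsto_const LIMSEQ_realpow_zero) auto
    ultimately have "eventually (\<lambda>n. 12 * l ^ n < \<delta>) sequentially"
      by (intro order_tendstoD(2)) auto
    then obtain n where n: "12 * l ^ n < \<delta>" by (meson eventually_sequentially order_refl)
    \<comment> \<open>One piece for each choice of the digits in the digit set; there are \<open>2 ^ card (?J n)\<close> choices.\<close>
    define F where "F S = radial l r ` cylinder (?J n) (\<lambda>i. i \<in> S)" for S
    have "K \<subseteq> (\<Union>S\<in>Pow (?J n). F S)"
    proof
      fix x assume "x \<in> K"
      then obtain a where "x = radial l r a" by (auto simp: K_def)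
      then have "x \<in> F {i \<in> ?J n. a i}" by (auto simp: F_def cylinder_def)
      then show "x \<in> (\<Union>S\<in>Pow (?J n). F S)" by (intro UN_I[of "{i \<in> ?J n. a i}"]) auto
    qed
    moreover have "dist y z \<le> 12 * l ^ n" if "y \<in> F S" "z \<in> F S" for y z S
      using that by (auto simp: F_def cylinder_def intro!: radial_close[OF l, of r])
    ultimately have "hausdorff_premeasure \<delta> t K \<le> ennreal (card (Pow (?J n)) * (12 * l ^ n) powr t)"
      using n l t by (intro hausdorff_premeasure_finite_cover) (auto simp: finite_digit_set)
    also have "card (Pow (?J n)) * (12 * l ^ n) powr t = 12 powr t * (2 powr card (?J n) * (l powr t) ^ n)"
    proof -
      have "(l ^ n) powr t = (l powr t) ^ n"
        using l by (induction n) (simp_all add: powr_mult)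
      then show ?thesis using l by (simp add: card_Pow finite_digit_set powr_mult powr_realpow)
    qed
    also have "\<dots> \<le> 12 powr t * 1"
    proof (intro mult_left_mono)
      have "2 powr card (?J n) * (l powr t) ^ n = 2 powr (card (?J n) - (2 - r) * n)"
        unfolding lt by (simp flip: powr_add add: algebra_simps)
      also have "\<dots> \<le> 2 powr 0" using card_digit_set_bounds(2)[OF r, of n] by (intro powr_mono) auto
      finally show "2 powr card (?J n) * (l powr t) ^ n \<le> 1" by simp
    qed auto
    finally show "hausdorff_premeasure \<delta> t K \<le> ennreal (12 powr t)" by (simp add: ennreal_leI)
  qed
  then have "hausdorff_measure t K < \<infinity>" by (rule order.strict_trans1) simp
  ultimately obtain E where dim: "hausdorff_dim E \<le> ennreal \<gamma>"
    and ae: "hausdorff_ae_in t K (\<lambda>x. \<forall>e\<in>unit_circle - E. at_least_two (K \<inter> line_through x e))"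
    using adm unfolding gamma_admissible_def by blast
  define B where "B = {x \<in> K. \<not> (\<forall>e\<in>unit_circle - E. at_least_two (K \<inter> line_through x e))}"
  define c where "c = (1 - 2 * l) / (1 - l)"
  have c: "0 < c" using l by (simp add: c_def)
  \<comment> \<open>Each cylinder over the digit set has mass at most \<open>2 * (l ^ n) powr t\<close>, the factor \<open>2\<close> absorbing the rounding in its cardinality.\<close>
  have "\<exists>N\<in>null_sets coin_measure. radial l r -` B \<subseteq> N"
  proof (rule hausdorff_null_preimage[where J = ?J and c = "c / 3" and l = l and C = 2 and s = t])
    show "a i = b i" if "dist (radial l r a) (radial l r b) < c / 3 * l ^ n" "i \<in> ?J n" for n a b i
      using that radial_separated[OF l] by (simp add: c_def)
    show "(1 / 2) ^ card (?J n) \<le> 2 * (l powr t) ^ n" for n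
    proof -
      have "(1 / 2 :: real) ^ card (?J n) = 2 powr (- real (card (?J n)))"
        by (simp add: powr_minus powr_realpow power_one_over field_simps)
      also have "\<dots> \<le> 2 powr (1 - (2 - r) * n)"
        using card_digit_set_bounds(1)[OF r, of n] by (intro powr_mono) auto
      also have "\<dots> = 2 * (l powr t) ^ n"
        unfolding lt by (simp add: powr_add powr_diff powr_minus field_simps)
      finally show ?thesis .
    qed
    show "hausdorff_measure t B = 0" using ae by (simp add: hausdorff_ae_in_def B_def)
  qed (use l c t in \<open>auto simp: finite_digit_set\<close>)
  then obtain N1 where N1: "N1 \<in> null_sets coin_measure" "radial l r -` B \<subseteq> N1" by blast
  have "hausdorff_dim E < ennreal d" using dim d0 \<gamma> by (auto intro: order.strict_trans1 simp: ennreal_less_iff)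
  then obtain s where s: "0 \<le> s" "hausdorff_measure s E = 0" "s < d"
    unfolding hausdorff_dim_def INF_less_iff by (auto simp: ennreal_less_iff)
  \<comment> \<open>Here \<open>1 / 2 = l powr d \<le> l powr s\<close>, so the first \<open>n\<close> digits alone suffice.\<close>
  have "\<exists>N\<in>null_sets coin_measure. (\<lambda>a. ray_dir (cantor_value l a)) -` E \<subseteq> N"
  proof (rule hausdorff_null_preimage[where J = "\<lambda>n. {..<n}" and c = "c / 9" and l = l and C = 1 and s = s])
    show "a i = b i" if "dist (ray_dir (cantor_value l a)) (ray_dir (cantor_value l b)) < c / 9 * l ^ n" "i \<in> {..<n}" for n a b i
    proof (rule cantor_value_separated[OF l])
      have "\<bar>cantor_value l a - cantor_value l b\<bar> \<le> 9 * dist (ray_dir (cantor_value l a)) (ray_dir (cantor_value l b))"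
        using cantor_value_le_2[OF l] by (intro ray_dir_expands)
      also have "\<dots> < c * l ^ n" using that(1) by simp
      finally show "\<bar>cantor_value l a - cantor_value l b\<bar> < (1 - 2 * l) / (1 - l) * l ^ n" unfolding c_def .
      show "i \<le> n" using that(2) by simp
    qed
    show "(1 / 2) ^ card {..<n} \<le> 1 * (l powr s) ^ n" for n
    proof -
      have "2 powr (- 1) \<le> 2 powr (- s / d)" using s d0 by (intro powr_mono) (auto simp: field_simps)
      then have "1 / 2 \<le> l powr s" by (simp add: lpow powr_minus)
      then show ?thesis by (simp add: power_mono)
    qed
  qed (use l c s in auto)
  then obtain N2 where N2: "N2 \<in> null_sets coin_measure" "(\<lambda>a. ray_dir (cantor_value l a)) -` E \<subseteq> N2" by blast
  have "a \<in> N1 \<union> N2" for a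
  proof (cases "ray_dir (cantor_value l a) \<in> E")
    case True
    then show ?thesis using N2 by auto
  next
    case False
    let ?L = "K \<inter> line_through (radial l r a) (ray_dir (cantor_value l a))"
    have sub: "?L \<subseteq> {radial l r a}" unfolding K_def using l by (rule radial_line)
    then have "finite ?L" "card ?L \<le> 1" using card_mono[OF _ sub] by (auto intro: finite_subset)
    then have "\<not> at_least_two ?L" by (simp add: at_least_two_def)
    then have "radial l r a \<in> B" using False ray_dir_circle by (auto simp: B_def K_def)
    then show ?thesis using N1 by auto
  qed
  then have "space coin_measure \<in> null_sets coin_measure"
    using null_sets.Un[OF N1(1) N2(1)] by (metis UNIV_eq_I space_coin_measure)
  then show False using prob_space.emeasure_space_1[OF prob_space_coin_measure] by (simp add: null_sets_def)
qed

theorem propositionB1: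
  fixes t :: real
  assumes "t \<in> {1<..<2}"
  shows "gamma_exponent t = 1"
  unfolding gamma_exponent_def
proof (rule cInf_eq_minimum)
  show "1 \<in> {\<gamma> \<in> {0..1}. gamma_admissible t \<gamma>}" by (simp add: gamma_admissible_1)
  show "1 \<le> \<gamma>" if "\<gamma> \<in> {\<gamma> \<in> {0..1}. gamma_admissible t \<gamma>}" for \<gamma>
    using that not_gamma_admissible[of t \<gamma>] assms by force
qed

end
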